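(* Let $v_1,\ldots,v_p$ be positive integers. The complete multipartite graph $K_{v_1,v_2,\ldots,v_p}$ is $\{-1,1\}$-diagonalizable if and only if $v_1=v_2=\cdots=v_p$ and both $p$ and $v_1$ belong to $\{1\}\cup\{2k : k\in\mathbb{Z}_{+}\}$.
   Context: For a simple graph with adjacency matrix $A$ and degree matrix $D$, the Laplacian is $L=D-A$. A graph is $\{-1,1\}$-diagonalizable if there is an invertible matrix $P$ with all entries in $\{-1,1\}$ such that $P^{-1}LP$ is diagonal (equivalently, $L$ has a basis of eigenvectors with all entries in $\{-1,1\}$).
   Formalization: The case p = 1 with v_1 odd and at least 3 is excluded: there the graph has no edges, L = 0, and any invertible matrix with entries in {-1,1} diagonalizes it, so the stated equivalence fails exactly in that case. *)

theory Defs
  imports "Graph_Theory.Pair_Digraph" "Jordan_Normal_Form.Matrix"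
begin

text \<open>
  A simple graph is a \<open>pair_graph\<close>: finite, loop-free and symmetric, each edge being stored
  as two opposite arcs, so that \<open>out_degree\<close> is the degree.
\<close>

text \<open>Rows and columns follow the enumeration \<open>xs\<close> of the vertices.\<close>

definition adjacency_mat :: "'a list \<Rightarrow> 'a pair_pre_digraph \<Rightarrow> real mat" where
  "adjacency_mat xs G = mat (length xs) (length xs)
     (\<lambda>(i, j). if (xs ! i, xs ! j) \<in> parcs G then 1 else 0)"

definition degree_mat :: "'a list \<Rightarrow> 'a pair_pre_digraph \<Rightarrow> real mat" where
  "degree_mat xs G = mat (length xs) (length xs)
     (\<lambda>(i, j). if i = j then real (out_degree (with_proj G) (xs ! i)) else 0)"

definition laplacian_mat :: "'a list \<Rightarrow> 'a pair_pre_digraph \<Rightarrow> real mat" where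
  "laplacian_mat xs G = degree_mat xs G - adjacency_mat xs G"

text \<open>
  The choice of the enumeration \<open>xs\<close> is immaterial: another one conjugates the Laplacian
  by a permutation matrix, and permuting the rows of \<open>P\<close> keeps its entries in \<open>{-1, 1}\<close>.
  \<open>Q\<close> is the inverse of \<open>P\<close>.
\<close>

definition pm1_diagonalizable :: "'a pair_pre_digraph \<Rightarrow> bool" where
  "pm1_diagonalizable G \<longleftrightarrow>
     (\<exists>xs. distinct xs \<and> set xs = pverts G \<and>
       (\<exists>P \<in> carrier_mat (length xs) (length xs). \<exists>Q \<in> carrier_mat (length xs) (length xs).
          elements_mat P \<subseteq> {-1, 1} \<and> inverts_mat P Q \<and> inverts_mat Q P \<and>
          diagonal_mat (Q * laplacian_mat xs G * P)))"

text \<open>The parts are numbered \<open>1, \<dots>, p\<close>; the vertices \<open>(i, a)\<close> with \<open>a < v i\<close> form part \<open>i\<close>.\<close>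

definition complete_multipartite :: "nat \<Rightarrow> (nat \<Rightarrow> nat) \<Rightarrow> (nat \<times> nat) pair_pre_digraph" where
  "complete_multipartite p v =
     (let V = (SIGMA i:{1..p}. {..<v i})
      in \<lparr>pverts = V, parcs = {(x, y). x \<in> V \<and> y \<in> V \<and> fst x \<noteq> fst y}\<rparr>)"

lemma pair_graph_complete_multipartite: "pair_graph (complete_multipartite p v)"
proof -
  let ?V = "SIGMA i:{1..p}. {..<v i}"
  have "finite {(x, y). x \<in> ?V \<and> y \<in> ?V \<and> fst x \<noteq> fst y}"
    by (rule finite_subset[of _ "?V \<times> ?V"]) auto
  then show ?thesis
    by unfold_locales
      (auto simp: complete_multipartite_def Let_def symmetric_def intro!: symI)
qed

text \<open>
  With a single part the graph is edgeless and its Laplacian is zero, so that every invertible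
  matrix with entries in \<open>{-1, 1}\<close> diagonalizes it; for \<open>n \<noteq> 2\<close>, twice the identity minus
  the all-ones matrix is one.
  Hence a single part of odd size at least 3 has to be excluded from the characterization: such
  a graph is diagonalizable although its size is neither 1 nor even.
\<close>

lemma pm1_diagonalizable_single_part:
  assumes "v 1 > 2"
  shows "pm1_diagonalizable (complete_multipartite 1 v)"
proof -
  define n where "n = v 1"
  define xs where "xs = map (Pair (1::nat)) [0..<n]"
  define b where "b = 1 / (2 * (2 - real n))"
  define P where "P = mat n n (\<lambda>(i, j). if i = j then 1 else -1 :: real)"
  define Q where "Q = mat n n (\<lambda>(i, j). (if i = j then 1/2 else 0) + b)"
  have n: "n > 2" using assms by (simp add: n_def)
  have "(2 - real n) * b = 1/2" using n by (simp add: b_def)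
  then have b: "2 * b - real n * b = 1/2" by (simp add: left_diff_distrib)
  have len: "length xs = n" by (simp add: xs_def)
  have set: "set xs = pverts (complete_multipartite 1 v)"
    by (auto simp: xs_def complete_multipartite_def Let_def n_def)
  have P': "P $$ (i, j) = (if i = j then 2 else 0) - 1" if "i < n" "j < n" for i j
    using that by (simp add: P_def)
  have carr: "P \<in> carrier_mat n n" "Q \<in> carrier_mat n n" by (auto simp: P_def Q_def)
  have sumP: "(\<Sum>k<n. ((if i = k then 2 else 0) - 1) * ((if k = j then 1/2 else 0) + b))
      = (if i = j then 1 else 0)" (is "?s = _") if "i < n" "j < n" for i j
  proof -
    have "?s = (\<Sum>k<n. (if i = k then 2 * ((if i = j then 1/2 else 0) + b) else 0)
                     - (if k = j then 1/2 else 0) - b)"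
      by (rule sum.cong) auto
    also have "\<dots> = 2 * ((if i = j then 1/2 else 0) + b) - 1/2 - real n * b"
      using that by (simp add: sum_subtractf)
    finally show ?thesis using b by auto
  qed
  have PQ: "P * Q = 1\<^sub>m n"
    by (rule eq_matI)
      (use carr in \<open>auto simp: scalar_prod_def P' Q_def atLeast0LessThan sumP\<close>)
  have QP: "Q * P = 1\<^sub>m n"
  proof (rule eq_matI)
    fix i j assume "i < dim_row (1\<^sub>m n)" "j < dim_col (1\<^sub>m n)"
    then have ij: "i < n" "j < n" by auto
    then have "(Q * P) $$ (i, j)
        = (\<Sum>k<n. ((if j = k then 2 else 0) - 1) * ((if k = i then 1/2 else 0) + b))"
      using carr by (auto simp: scalar_prod_def P' Q_def atLeast0LessThan intro!: sum.cong)
    then show "(Q * P) $$ (i, j) = 1\<^sub>m n $$ (i, j)"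
      using ij sumP[of j i] by auto
  qed (use carr in auto)
  have L: "laplacian_mat xs (complete_multipartite 1 v) = 0\<^sub>m n n"
  proof -
    have "parcs (complete_multipartite 1 v) = {}"
      by (auto simp: complete_multipartite_def Let_def)
    then show ?thesis
      by (intro eq_matI) (auto simp: laplacian_mat_def degree_mat_def adjacency_mat_def len
          out_degree_def out_arcs_def)
  qed
  have "Q * 0\<^sub>m n n * P = 0\<^sub>m n n" using carr by auto
  then show ?thesis
    unfolding pm1_diagonalizable_def
    by (intro exI[of _ xs] conjI bexI[of _ P] bexI[of _ Q])
      (use carr PQ QP L len set in \<open>auto simp: inverts_mat_def diagonal_mat_def xs_def
          distinct_map inj_on_def P_def split: if_splits dest!: elements_matD\<close>)
qed

end

theory Submission
  imports Defs "Jordan_Normal_Form.Determinant"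
begin

text \<open>
  Let \<open>x\<close> be an eigenfunction with values in \<open>{-1, 1}\<close> for the eigenvalue \<open>\<lambda>\<close>. If \<open>S\<close> is its sum
  and \<open>S\<^sub>i\<close> its sum over part \<open>i\<close>, then \<open>(n - v\<^sub>i - \<lambda>) x = S - S\<^sub>i\<close> on part \<open>i\<close>. Hence if \<open>x\<close> is not
  constant on part \<open>i\<close>, then \<open>\<lambda> = n - v\<^sub>i\<close> and \<open>S = S\<^sub>i\<close>. For a part \<open>j\<close> with \<open>v\<^sub>j \<noteq> v\<^sub>i\<close> this makes \<open>x\<close>
  a constant \<open>c\<close> on part \<open>j\<close> with \<open>S = c v\<^sub>i\<close>, which forces \<open>x = c\<close> on part \<open>i\<close>. So as soon as some
  part has two vertices, all parts have the same size; then all \<open>S\<^sub>j\<close> equal \<open>S\<close>, so \<open>S = 0\<close> if \<open>p > 1\<close>, and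
  the common size is even. An eigenfunction with \<open>S\<^sub>1 \<noteq> S\<^sub>2\<close> is constant on the parts and sums to zero,
  so the number of parts is even. Since the eigenfunctions form a basis, both kinds occur in it.

  Conversely, for \<open>m = 1\<close> and for \<open>m\<close> even there is a basis of \<open>\<real>\<^sup>m\<close> consisting of the all-ones
  vector and vectors with entries in \<open>{-1, 1}\<close> that sum to zero. The tensor products of two such
  bases, of sizes \<open>p\<close> and \<open>v\<^sub>1\<close>, are eigenfunctions.
\<close>

section \<open>Eigenbases of functions on the vertices\<close>

text \<open>The degree term is spread over the neighbours, so the operator needs no enumeration of
  the vertices.\<close>

definition laplacian_fun :: "'a pair_pre_digraph \<Rightarrow> ('a \<Rightarrow> real) \<Rightarrow> 'a \<Rightarrow> real" where
  "laplacian_fun G f u = (\<Sum>w | (u, w) \<in> parcs G. f u - f w)"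

lemma out_degree_with_proj: "out_degree (with_proj G) u = card {w. (u, w) \<in> parcs G}"
proof -
  have "out_arcs (with_proj G) u = Pair u ` {w. (u, w) \<in> parcs G}"
    by (auto simp: out_arcs_def)
  then show ?thesis
    by (simp add: out_degree_def card_image inj_on_def)
qed

lemma laplacian_mat_carrier: "laplacian_mat xs G \<in> carrier_mat (length xs) (length xs)"
  by (intro carrier_matI) (simp_all add: laplacian_mat_def degree_mat_def adjacency_mat_def)

lemma sum_laplacian_mat:
  assumes G: "pair_graph G" and xs: "distinct xs" "set xs = pverts G" and k: "k < length xs"
  shows "(\<Sum>l<length xs. laplacian_mat xs G $$ (k, l) * g (xs ! l)) = laplacian_fun G g (xs ! k)"
proof -
  interpret pair_graph G by (rule G)
  let ?u = "xs ! k" and ?N = "{w. (xs ! k, w) \<in> parcs G}"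
  have N: "?N \<subseteq> pverts G"
    by (auto dest: in_arcsD2)
  have bij: "bij_betw ((!) xs) {..<length xs} (pverts G)"
    by (rule bij_betw_nth) (use xs in auto)
  have "(\<Sum>l<length xs. laplacian_mat xs G $$ (k, l) * g (xs ! l)) =
      (\<Sum>l<length xs. (if k = l then real (card ?N) * g ?u else 0)
        - (if xs ! l \<in> ?N then g (xs ! l) else 0))"
    by (rule sum.cong)
      (use k in \<open>auto simp: laplacian_mat_def degree_mat_def adjacency_mat_def
        out_degree_with_proj left_diff_distrib\<close>)
  also have "\<dots> = real (card ?N) * g ?u - (\<Sum>l<length xs. if xs ! l \<in> ?N then g (xs ! l) else 0)"
    using k by (simp add: sum_subtractf)
  also have "(\<Sum>l<length xs. if xs ! l \<in> ?N then g (xs ! l) else 0)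
      = (\<Sum>w\<in>pverts G. if w \<in> ?N then g w else 0)"
    by (rule sum.reindex_bij_betw[OF bij])
  also have "\<dots> = sum g ?N"
    using N pair_finite_verts by (simp add: sum.If_cases Int_absorb1)
  also have "real (card ?N) * g ?u - sum g ?N = laplacian_fun G g ?u"
    by (simp add: laplacian_fun_def sum_subtractf)
  finally show ?thesis .
qed

text \<open>The last clause says that the functions, as many as there are vertices, span: only zero
  is orthogonal to all of them. In this dual form every nonzero test vector yields a member not
  orthogonal to it.\<close>

definition pm1_eigenbasis ::
  "'a pair_pre_digraph \<Rightarrow> (nat \<Rightarrow> 'a \<Rightarrow> real) \<Rightarrow> (nat \<Rightarrow> real) \<Rightarrow> bool" where
  "pm1_eigenbasis G f ev \<longleftrightarrow>
     (\<forall>j<card (pverts G). \<forall>u\<in>pverts G.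
        f j u \<in> {-1, 1} \<and> laplacian_fun G (f j) u = ev j * f j u) \<and>
     (\<forall>y. (\<forall>j<card (pverts G). (\<Sum>u\<in>pverts G. y u * f j u) = 0) \<longrightarrow> (\<forall>u\<in>pverts G. y u = 0))"

lemma index_mult_mat_sum:
  assumes "A \<in> carrier_mat n m" "B \<in> carrier_mat m r" "i < n" "j < r"
  shows "(A * B) $$ (i, j) = (\<Sum>k<m. A $$ (i, k) * B $$ (k, j))"
  using assms by (auto simp: scalar_prod_def atLeast0LessThan)

text \<open>The columns of \<open>P\<close> are the eigenfunctions, as \<open>Q * L * P = D\<close>
  gives \<open>L * P = P * D\<close>. A vector orthogonal to all columns is killed by
  \<open>P\<close>, hence by \<open>P * Q\<close>, which is the identity.\<close>

lemma pm1_diagonalizable_imp_eigenbasis: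
  assumes G: "pair_graph G" and diag: "pm1_diagonalizable G"
  obtains f ev where "pm1_eigenbasis G f ev"
proof -
  obtain xs P Q where xs: "distinct xs" "set xs = pverts G"
    and P: "P \<in> carrier_mat (length xs) (length xs)" and Q: "Q \<in> carrier_mat (length xs) (length xs)"
    and el: "elements_mat P \<subseteq> {-1, 1}" and inv: "inverts_mat P Q" "inverts_mat Q P"
    and dg: "diagonal_mat (Q * laplacian_mat xs G * P)"
    using diag unfolding pm1_diagonalizable_def by blast
  define n where "n = length xs"
  define L where "L = laplacian_mat xs G"
  define D where "D = Q * L * P"
  define ix where "ix = inv_into {..<n} ((!) xs)"
  define f where "f j u = P $$ (ix u, j)" for j u
  have L: "L \<in> carrier_mat n n"
    by (simp add: L_def n_def laplacian_mat_carrier)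
  note dg = dg[folded L_def, folded D_def] and P = P[folded n_def] and Q = Q[folded n_def]
  have PQ: "P * Q = 1\<^sub>m n"
    using inv P by (simp add: inverts_mat_def)
  have D: "D \<in> carrier_mat n n"
    using P Q L by (auto simp: D_def)
  have PD: "P * D = L * P"
  proof -
    have "P * D = P * (Q * (L * P))"
      using P Q L by (simp add: D_def assoc_mult_mat[of Q n n])
    also have "\<dots> = (P * Q) * (L * P)"
      using P Q L by (intro assoc_mult_mat[symmetric]) auto
    finally show ?thesis using L P by (simp add: PQ)
  qed
  have n: "n = card (pverts G)"
    using xs by (metis distinct_card n_def)
  have bij: "bij_betw ((!) xs) {..<n} (pverts G)"
    by (rule bij_betw_nth) (use xs n_def in auto)
  have ix: "ix (xs ! k) = k" if "k < n" for k
    unfolding ix_def by (rule inv_into_f_f) (use that bij in \<open>auto simp: bij_betw_def\<close>)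
  have vert: "\<exists>k<n. u = xs ! k" if "u \<in> pverts G" for u
    using that bij by (auto simp: bij_betw_def)
  have pm: "f j (xs ! k) \<in> {-1, 1}" if "j < n" "k < n" for j k
    unfolding f_def ix[OF that(2)]
    by (rule subsetD[OF el], rule elements_matI[OF P]) (use that in simp_all)
  have eigen: "laplacian_fun G (f j) (xs ! k) = D $$ (j, j) * f j (xs ! k)"
    if "j < n" "k < n" for j k
  proof -
    have "laplacian_fun G (f j) (xs ! k) = (\<Sum>l<n. L $$ (k, l) * P $$ (l, j))"
      using sum_laplacian_mat[OF G xs, of k "f j"] that(2)
      by (simp add: n_def[symmetric] L_def f_def ix)
    also have "\<dots> = (P * D) $$ (k, j)"
      unfolding PD using index_mult_mat_sum[OF L P] that by simp
    also have "\<dots> = (\<Sum>l<n. if l = j then P $$ (k, j) * D $$ (j, j) else 0)"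
      unfolding index_mult_mat_sum[OF P D that(2,1)]
      by (rule sum.cong) (use dg D that in \<open>auto simp: diagonal_mat_def\<close>)
    also have "\<dots> = D $$ (j, j) * f j (xs ! k)"
      using that by (simp add: f_def ix)
    finally show ?thesis .
  qed
  have complete: "y (xs ! k) = 0"
    if y: "\<forall>j<n. (\<Sum>u\<in>pverts G. y u * f j u) = 0" and k: "k < n" for y k
  proof -
    have y': "(\<Sum>l<n. y (xs ! l) * P $$ (l, j)) = 0" if "j < n" for j
    proof -
      have "(\<Sum>l<n. y (xs ! l) * f j (xs ! l)) = 0"
        using y that sum.reindex_bij_betw[OF bij, of "\<lambda>u. y u * f j u"] by simp
      then show ?thesis by (simp add: f_def ix)
    qed
    have "y (xs ! k) = (\<Sum>l<n. y (xs ! l) * (P * Q) $$ (l, k))"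
      unfolding PQ using k by (simp add: if_distrib sum.If_cases cong: if_cong)
    also have "\<dots> = (\<Sum>l<n. \<Sum>j<n. y (xs ! l) * P $$ (l, j) * Q $$ (j, k))"
      by (rule sum.cong)
        (use k in \<open>simp_all add: index_mult_mat_sum[OF P Q] sum_distrib_left mult.assoc\<close>)
    also have "\<dots> = (\<Sum>j<n. (\<Sum>l<n. y (xs ! l) * P $$ (l, j)) * Q $$ (j, k))"
      by (subst sum.swap) (simp add: sum_distrib_right)
    also have "\<dots> = 0" by (simp add: y')
    finally show ?thesis .
  qed
  have "pm1_eigenbasis G f (\<lambda>j. D $$ (j, j))"
    unfolding pm1_eigenbasis_def n[symmetric]
    using pm eigen complete by (blast dest: vert)
  then show thesis by (rule that)
qed

text \<open>The functions become the columns of \<open>P\<close>. Completeness says that the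
  transpose of \<open>P\<close> has trivial kernel, so \<open>P\<close> is invertible.\<close>

lemma pm1_eigenbasis_imp_diagonalizable:
  assumes G: "pair_graph G" and basis: "pm1_eigenbasis G f ev"
  shows "pm1_diagonalizable G"
proof -
  interpret pair_graph G by (rule G)
  obtain xs where xs: "set xs = pverts G" "distinct xs"
    using finite_distinct_list[OF pair_finite_verts] by blast
  define n where "n = length xs"
  have n: "n = card (pverts G)"
    using xs by (metis distinct_card n_def)
  have bij: "bij_betw ((!) xs) {..<n} (pverts G)"
    by (rule bij_betw_nth) (use xs n_def in auto)
  have V: "xs ! k \<in> pverts G" if "k < n" for k
    using that xs n_def nth_mem by blast
  note basis = basis[unfolded pm1_eigenbasis_def, folded n]
  define P where "P = mat n n (\<lambda>(k, j). f j (xs ! k))"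
  define D where "D = mat n n (\<lambda>(i, j). if i = j then ev j else 0)"
  define L where "L = laplacian_mat xs G"
  have P: "P \<in> carrier_mat n n" and D: "D \<in> carrier_mat n n" by (simp_all add: P_def D_def)
  have L: "L \<in> carrier_mat n n"
    by (simp add: L_def n_def laplacian_mat_carrier)
  have "det P\<^sup>T \<noteq> 0"
  proof
    assume "det P\<^sup>T = 0"
    then obtain w where w: "w \<in> carrier_vec n" "w \<noteq> 0\<^sub>v n" "P\<^sup>T *\<^sub>v w = 0\<^sub>v n"
      using det_0_iff_vec_prod_zero[of "P\<^sup>T" n] P by auto
    define y where "y u = w $ inv_into {..<n} ((!) xs) u" for u
    have y: "y (xs ! k) = w $ k" if "k < n" for k
      unfolding y_def by (subst inv_into_f_f) (use that bij in \<open>auto simp: bij_betw_def\<close>)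
    have "(\<Sum>u\<in>pverts G. y u * f j u) = 0" if "j < n" for j
    proof -
      have "(\<Sum>u\<in>pverts G. y u * f j u) = (\<Sum>k<n. y (xs ! k) * f j (xs ! k))"
        by (rule sum.reindex_bij_betw[OF bij, symmetric])
      also have "\<dots> = (P\<^sup>T *\<^sub>v w) $ j"
        using that P w(1) by (auto simp: scalar_prod_def P_def y atLeast0LessThan mult.commute
            intro!: sum.cong)
      finally show ?thesis using w that by simp
    qed
    then have "\<forall>u\<in>pverts G. y u = 0"
      using basis by blast
    then have "w = 0\<^sub>v n"
      using w(1) V y by (intro eq_vecI) auto
    then show False using w by simp
  qed
  then have "det P \<noteq> 0"
    using det_transpose[OF P] by simp
  then have "P \<in> Units (ring_mat TYPE(real) n ())"
    by (rule det_non_zero_imp_unit[OF P])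
  then obtain Q where Q: "Q \<in> carrier_mat n n" and QP: "Q * P = 1\<^sub>m n" and PQ: "P * Q = 1\<^sub>m n"
    by (auto simp: Units_def ring_mat_def)
  have LP: "L * P = P * D"
  proof (rule eq_matI)
    fix k j assume "k < dim_row (P * D)" "j < dim_col (P * D)"
    then have kj: "k < n" "j < n" using P D by auto
    have "(L * P) $$ (k, j) = (\<Sum>l<n. L $$ (k, l) * f j (xs ! l))"
      unfolding index_mult_mat_sum[OF L P kj] using kj by (simp add: P_def)
    also have "\<dots> = ev j * f j (xs ! k)"
      using sum_laplacian_mat[OF G xs(2,1), of k "f j"] basis V kj
      by (simp add: n_def[symmetric] L_def)
    also have "\<dots> = (P * D) $$ (k, j)"
      unfolding index_mult_mat_sum[OF P D kj] using kj
      by (simp add: P_def D_def if_distrib sum.If_cases cong: if_cong)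
    finally show "(L * P) $$ (k, j) = (P * D) $$ (k, j)" .
  qed (use L P D in auto)
  have "Q * L * P = Q * (P * D)"
    using P Q L by (simp add: assoc_mult_mat[of Q n n] LP)
  also have "\<dots> = (Q * P) * D"
    using P Q D by (intro assoc_mult_mat[symmetric]) auto
  finally have "Q * L * P = D" using D by (simp add: QP)
  then have "diagonal_mat (Q * L * P)"
    by (simp add: D_def diagonal_mat_def)
  moreover have "elements_mat P \<subseteq> {-1, 1}"
  proof
    fix e assume "e \<in> elements_mat P"
    then obtain k j where "k < n" "j < n" "e = f j (xs ! k)"
      by (auto simp: P_def dest!: elements_matD)
    then show "e \<in> {-1, 1}" using basis V by blast
  qed
  ultimately show ?thesis
    unfolding pm1_diagonalizable_def
    by (intro exI[of _ xs] conjI bexI[of _ P] bexI[of _ Q])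
      (use P Q PQ QP xs in \<open>auto simp: inverts_mat_def L_def n_def[symmetric]\<close>)
qed

section \<open>Eigenfunctions of complete multipartite graphs\<close>

abbreviation part_sum :: "(nat \<Rightarrow> nat) \<Rightarrow> (nat \<times> nat \<Rightarrow> real) \<Rightarrow> nat \<Rightarrow> real" where
  "part_sum v x i \<equiv> (\<Sum>a<v i. x (i, a))"

lemma pverts_complete_multipartite:
  "pverts (complete_multipartite p v) = (SIGMA i:{1..p}. {..<v i})"
  by (simp add: complete_multipartite_def Let_def)

lemma sum_pverts_complete_multipartite:
  fixes x :: "nat \<times> nat \<Rightarrow> real"
  shows "sum x (pverts (complete_multipartite p v)) = (\<Sum>i=1..p. part_sum v x i)"
  by (simp add: pverts_complete_multipartite sum.Sigma)

text \<open>A vertex of part \<open>i\<close> is adjacent to exactly the vertices of the other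
  parts, so each sum over neighbours is a full sum with the contribution of part \<open>i\<close>
  removed.\<close>

lemma laplacian_fun_complete_multipartite:
  assumes "i \<in> {1..p}" "a < v i"
  shows "laplacian_fun (complete_multipartite p v) x (i, a) =
    (\<Sum>k=1..p. real (v k)) * x (i, a) - real (v i) * x (i, a)
      - ((\<Sum>k=1..p. part_sum v x k) - part_sum v x i)"
proof -
  have "{w. ((i, a), w) \<in> parcs (complete_multipartite p v)} = (SIGMA k:{1..p} - {i}. {..<v k})"
    using assms by (auto simp: complete_multipartite_def Let_def)
  then have "laplacian_fun (complete_multipartite p v) x (i, a) =
      (\<Sum>k\<in>{1..p} - {i}. \<Sum>b<v k. x (i, a) - x (k, b))"
    by (simp add: laplacian_fun_def sum.Sigma)
  also have "\<dots> = (\<Sum>k\<in>{1..p} - {i}. real (v k) * x (i, a) - part_sum v x k)"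
    by (simp add: sum_subtractf)
  also have "\<dots> = (\<Sum>k=1..p. real (v k) * x (i, a) - part_sum v x k)
      - (real (v i) * x (i, a) - part_sum v x i)"
    using assms(1) by (subst sum_diff1) auto
  finally show ?thesis by (simp add: sum_subtractf sum_distrib_right)
qed

section \<open>Sums of signs: parity and the extremal case\<close>

lemma sum_pm1_eq_zero_imp_even:
  fixes f :: "'a \<Rightarrow> real"
  assumes "finite A" and pm: "\<And>a. a \<in> A \<Longrightarrow> f a \<in> {-1, 1}" and "sum f A = 0"
  shows "even (card A)"
proof -
  let ?B = "{a \<in> A. f a = 1}"
  have "sum f A = (\<Sum>a\<in>A. (if f a = 1 then 2 else 0) - 1)"
    by (rule sum.cong) (use pm in auto)
  also have "\<dots> = 2 * real (card ?B) - real (card A)"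
    using assms(1) by (simp add: sum_subtractf sum.If_cases Int_def)
  finally have "card A = 2 * card ?B" using assms(3) by linarith
  then show ?thesis by simp
qed

text \<open>The terms \<open>1 - c * f a\<close> are nonnegative and add up to zero.\<close>

lemma pm1_sum_eq_card_imp_eq:
  fixes f :: "'a \<Rightarrow> real"
  assumes "finite A" and pm: "\<And>a. a \<in> A \<Longrightarrow> f a \<in> {-1, 1}" and c: "c \<in> {-1, 1}"
    and sum: "sum f A = c * real (card A)" and "a \<in> A"
  shows "f a = c"
proof -
  have "(\<Sum>a\<in>A. 1 - c * f a) = 0"
    using c by (auto simp: sum_subtractf sum_distrib_left[symmetric] sum)
  then have "1 - c * f a = 0"
    by (subst (asm) sum_nonneg_eq_0_iff) (use assms in \<open>force+\<close>)
  then show ?thesis using c by auto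
qed

section \<open>Constraints on a single eigenfunction with values -1 and 1\<close>

locale multipartite_eigenfunction =
  fixes p :: nat and v :: "nat \<Rightarrow> nat" and x :: "nat \<times> nat \<Rightarrow> real" and ev :: real
  assumes pm1: "\<And>i a. i \<in> {1..p} \<Longrightarrow> a < v i \<Longrightarrow> x (i, a) \<in> {-1, 1}"
    and eigen: "\<And>i a. i \<in> {1..p} \<Longrightarrow> a < v i \<Longrightarrow>
      laplacian_fun (complete_multipartite p v) x (i, a) = ev * x (i, a)"
begin

abbreviation total :: real where "total \<equiv> \<Sum>k=1..p. part_sum v x k"

lemma eigen_equation:
  assumes "i \<in> {1..p}" "a < v i"
  shows "((\<Sum>k=1..p. real (v k)) - real (v i) - ev) * x (i, a) = total - part_sum v x i"
  using eigen[OF assms] laplacian_fun_complete_multipartite[of i p a v x] assms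
  by (simp add: algebra_simps)

lemma nonconstant_part:
  assumes i: "i \<in> {1..p}" "a < v i" "b < v i" and ne: "x (i, a) \<noteq> x (i, b)"
  shows "ev = (\<Sum>k=1..p. real (v k)) - real (v i)" and "part_sum v x i = total"
proof -
  have "((\<Sum>k=1..p. real (v k)) - real (v i) - ev) * (x (i, a) - x (i, b)) = 0"
    using eigen_equation[OF i(1,2)] eigen_equation[OF i(1,3)] by (simp add: right_diff_distrib)
  then show ev: "ev = (\<Sum>k=1..p. real (v k)) - real (v i)" using ne by simp
  show "part_sum v x i = total" using eigen_equation[OF i(1,2)] ev by simp
qed

lemma nonconstant_imp_equal_sizes:
  assumes i: "i \<in> {1..p}" "a < v i" "b < v i" and ne: "x (i, a) \<noteq> x (i, b)"
    and j: "j \<in> {1..p}" "v j > 0"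
  shows "v j = v i"
proof (rule ccontr)
  assume vne: "v j \<noteq> v i"
  note nc = nonconstant_part[OF i ne]
  define c where "c = x (j, 0)"
  have c: "c \<in> {-1, 1}" using pm1 j by (simp add: c_def)
  have eq: "(real (v i) - real (v j)) * x (j, b) = total - part_sum v x j" if "b < v j" for b
    using eigen_equation[OF j(1) that] nc(1) by simp
  have const: "x (j, b) = c" if "b < v j" for b
  proof -
    have "(real (v i) - real (v j)) * x (j, b) = (real (v i) - real (v j)) * c"
      unfolding c_def by (rule trans[OF eq[OF that] eq[OF j(2), symmetric]])
    then show ?thesis using vne by simp
  qed
  have "part_sum v x j = real (v j) * c" by (simp add: const)
  \<comment> \<open>The term \<open>v j * c\<close> occurs on both sides of \<open>eq\<close> and
    cancels.\<close>
  then have "total = real (v i) * c"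
    using eq[OF j(2)] by (simp add: c_def left_diff_distrib)
  then have "part_sum v x i = c * real (card {..<v i})"
    using nc(2) by simp
  then have "x (i, a') = c" if "a' < v i" for a'
    using pm1_sum_eq_card_imp_eq[of "{..<v i}" "\<lambda>a. x (i, a)" c a'] that pm1 i(1) c by simp
  then show False using i ne by simp
qed

end

locale equal_parts_eigenfunction = multipartite_eigenfunction +
  fixes m :: nat
  assumes equal_sizes: "\<And>i. i \<in> {1..p} \<Longrightarrow> v i = m" and m_pos: "m > 0"
begin

text \<open>With equal sizes the coefficient of \<open>x\<close> in \<open>eigen_equation\<close> is
  the same for all parts, and nonconstancy on one part makes it zero.\<close>

lemma nonconstant_imp_part_sum:
  assumes i: "i \<in> {1..p}" "a < v i" "b < v i" and ne: "x (i, a) \<noteq> x (i, b)"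
    and j: "j \<in> {1..p}"
  shows "part_sum v x j = total"
  using eigen_equation[of j 0] nonconstant_part(1)[OF i ne] equal_sizes[OF i(1)] equal_sizes[OF j]
    j m_pos by simp

lemma nonconstant_imp_even_size:
  assumes i: "i \<in> {1..p}" "a < v i" "b < v i" and ne: "x (i, a) \<noteq> x (i, b)" and p: "p \<noteq> 1"
  shows "even m"
proof -
  note ps = nonconstant_imp_part_sum[OF i ne]
  have "total = (\<Sum>k=1..p. total)"
    by (rule sum.cong[OF refl]) (rule ps)
  then have "total = real p * total" by simp
  then have "total = 0" using p by simp
  then have "part_sum v x i = 0" using ps[OF i(1)] by simp
  then show ?thesis
    using sum_pm1_eq_zero_imp_even[of "{..<v i}" "\<lambda>a. x (i, a)"] pm1 i(1) equal_sizes by simp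
qed

lemma part_sums_differ_imp_even_parts:
  assumes ij: "i \<in> {1..p}" "j \<in> {1..p}" and ne: "part_sum v x i \<noteq> part_sum v x j"
  shows "even p"
proof -
  define c where "c k = x (k, 0)" for k
  \<comment> \<open>A part on which \<open>x\<close> is not constant would force all part sums to
    equal \<open>total\<close>, against \<open>ne\<close>.\<close>
  have const: "x (k, a) = c k" if "k \<in> {1..p}" "a < m" for k a
  proof (rule ccontr)
    assume "x (k, a) \<noteq> c k"
    then have "part_sum v x l = total" if "l \<in> {1..p}" for l
      using nonconstant_imp_part_sum[of k a 0 l] that \<open>k \<in> {1..p}\<close> \<open>a < m\<close>
        equal_sizes[OF \<open>k \<in> {1..p}\<close>] m_pos by (simp add: c_def)
    from this[OF ij(1)] this[OF ij(2)] show False using ne by linarith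
  qed
  have ps: "part_sum v x k = real m * c k" if "k \<in> {1..p}" for k
    using const equal_sizes that by simp
  \<comment> \<open>On part \<open>k\<close> the term \<open>m * c k\<close> cancels from both sides
    of \<open>eigen_equation\<close>; the coefficient that remains is independent of the
    part.\<close>
  define \<mu> where "\<mu> = (\<Sum>k=1..p. real (v k)) - ev"
  have eq: "\<mu> * c k = total" if "k \<in> {1..p}" for k
    using eigen_equation[of k 0] that equal_sizes m_pos ps[OF that]
    by (simp add: \<mu>_def c_def left_diff_distrib)
  \<comment> \<open>Equal products with different factors \<open>c i\<close> and \<open>c j\<close>
    force \<mu> = 0, and with it \<open>total = 0\<close>.\<close>
  have "c i \<noteq> c j" using ne ps ij by auto
  moreover have "\<mu> * c i = \<mu> * c j" using eq ij by simp
  ultimately have "total = 0" using eq[OF ij(1)] by simp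
  moreover have "total = real m * (\<Sum>k=1..p. c k)"
    unfolding sum_distrib_left by (rule sum.cong) (use ps in auto)
  ultimately have "(\<Sum>k=1..p. c k) = 0" using m_pos by simp
  then show ?thesis
    using sum_pm1_eq_zero_imp_even[of "{1..p}" c] pm1 equal_sizes m_pos by (simp add: c_def)
qed

end

section \<open>Necessity: test vectors pick out suitable members of the basis\<close>

lemma complete_multipartite_necessary:
  assumes p: "p \<ge> 2" and pos: "\<And>i. i \<in> {1..p} \<Longrightarrow> v i > 0"
    and basis: "pm1_eigenbasis (complete_multipartite p v) f ev"
  shows "\<forall>i\<in>{1..p}. v i = v 1" and "even p" and "v 1 = 1 \<or> even (v 1)"
proof -
  let ?V = "pverts (complete_multipartite p v)"
  have eig: "multipartite_eigenfunction p v (f j) (ev j)" if "j < card ?V" for j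
    using basis that
    by unfold_locales (auto simp: pm1_eigenbasis_def pverts_complete_multipartite)
  have complete: "\<exists>j<card ?V. (\<Sum>u\<in>?V. y u * f j u) \<noteq> 0" if "u \<in> ?V" "y u \<noteq> 0" for y u
    using basis that unfolding pm1_eigenbasis_def by blast
  have fin: "finite ?V" by (simp add: pverts_complete_multipartite)
  have nonconst: "\<exists>j<card ?V. f j (i, 0) \<noteq> f j (i, 1)" if i: "i \<in> {1..p}" "v i \<ge> 2" for i
  proof -
    \<comment> \<open>This vector pairs with \<open>f j\<close> to the difference of its values at
      two vertices of part \<open>i\<close>, so completeness provides a member that is not constant
      there.\<close>
    let ?y = "\<lambda>u. of_bool (u = (i, 0)) - of_bool (u = (i, 1)) :: real"
    have V: "(i, 0) \<in> ?V" "(i, 1) \<in> ?V" using i by (auto simp: pverts_complete_multipartite)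
    have "(\<Sum>u\<in>?V. ?y u * f j u) = f j (i, 0) - f j (i, 1)" for j
      using V fin by (simp add: left_diff_distrib sum_subtractf)
    then show ?thesis using complete[OF V(1), of ?y] by auto
  qed
  show eq: "\<forall>i\<in>{1..p}. v i = v 1"
  proof (cases "\<exists>i\<in>{1..p}. v i \<ge> 2")
    case True
    then obtain i where i: "i \<in> {1..p}" "v i \<ge> 2" by blast
    then obtain j where j: "j < card ?V" "f j (i, 0) \<noteq> f j (i, 1)" using nonconst by blast
    interpret multipartite_eigenfunction p v "f j" "ev j" by (rule eig[OF j(1)])
    have "v k = v i" if "k \<in> {1..p}" for k
      using nonconstant_imp_equal_sizes[OF i(1) _ _ j(2) that pos[OF that]] i(2) by simp
    then show ?thesis using p by simp
  next
    case False
    then have "v i = 1" if "i \<in> {1..p}" for i using pos[OF that] that by force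
    then show ?thesis using p by simp
  qed
  have eig': "equal_parts_eigenfunction p v (f j) (ev j) (v 1)" if "j < card ?V" for j
  proof (intro equal_parts_eigenfunction.intro equal_parts_eigenfunction_axioms.intro)
    show "v i = v 1" if "i \<in> {1..p}" for i by (rule bspec[OF eq that])
  qed (use eig[OF that] pos[of 1] p in simp_all)
  show "v 1 = 1 \<or> even (v 1)"
  proof (cases "v 1 \<ge> 2")
    case True
    then obtain j where j: "j < card ?V" "f j (1, 0) \<noteq> f j (1, 1)" using nonconst[of 1] p by auto
    interpret equal_parts_eigenfunction p v "f j" "ev j" "v 1" by (rule eig'[OF j(1)])
    show ?thesis using nonconstant_imp_even_size[OF _ _ _ j(2)] p True by simp
  next
    case False
    then show ?thesis using pos[of 1] p by auto
  qed
  show "even p"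
  proof -
    \<comment> \<open>Here the pairing is the difference of the first two part sums, so completeness
      provides a member for which they differ.\<close>
    let ?y = "\<lambda>u. of_bool (fst u = 1) - of_bool (fst u = 2) :: real"
    have sum: "(\<Sum>u\<in>?V. ?y u * f j u) = part_sum v (f j) 1 - part_sum v (f j) 2" for j
    proof -
      \<comment> \<open>\<open>?y\<close> depends only on the part, so the 0 in
        \<open>(i, 0)\<close> is an arbitrary representative.\<close>
      have "(\<Sum>u\<in>?V. ?y u * f j u) = (\<Sum>i=1..p. ?y (i, 0::nat) * part_sum v (f j) i)"
        by (simp add: sum_pverts_complete_multipartite sum_distrib_left)
      also have "\<dots> = part_sum v (f j) 1 - part_sum v (f j) 2"
        using p by (simp add: left_diff_distrib sum_subtractf)
      finally show ?thesis .
    qed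
    have "(1, 0) \<in> ?V" using p pos[of 1] by (simp add: pverts_complete_multipartite)
    from complete[OF this, of ?y] obtain j where j: "j < card ?V"
      "part_sum v (f j) 1 \<noteq> part_sum v (f j) 2"
      unfolding sum by auto
    interpret equal_parts_eigenfunction p v "f j" "ev j" "v 1" by (rule eig'[OF j(1)])
    show ?thesis using part_sums_differ_imp_even_parts[OF _ _ j(2)] p by simp
  qed
qed

section \<open>Construction of an eigenbasis\<close>

text \<open>A weak form of a Hadamard matrix with all-ones first row: the other rows are orthogonal
  to the first, and the rows span, stated dually as in \<open>pm1_eigenbasis\<close>. This admits
  even orders such as 6, for which no Hadamard matrix exists.\<close>

definition balanced_pm1_basis :: "nat \<Rightarrow> (nat \<Rightarrow> nat \<Rightarrow> real) \<Rightarrow> bool" where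
  "balanced_pm1_basis m b \<longleftrightarrow>
     (\<forall>j<m. \<forall>i<m. b j i \<in> {-1, 1}) \<and> (\<forall>i<m. b 0 i = 1) \<and>
     (\<forall>j<m. j > 0 \<longrightarrow> (\<Sum>i<m. b j i) = 0) \<and>
     (\<forall>y. (\<forall>j<m. (\<Sum>i<m. y i * b j i) = 0) \<longrightarrow> (\<forall>i<m. y i = 0))"

lemma balanced_pm1_basisD:
  assumes "balanced_pm1_basis m b"
  shows "j < m \<Longrightarrow> i < m \<Longrightarrow> b j i \<in> {-1, 1}" and "i < m \<Longrightarrow> b 0 i = 1"
    and "j < m \<Longrightarrow> j > 0 \<Longrightarrow> sum (b j) {..<m} = 0"
    and "(\<And>j. j < m \<Longrightarrow> (\<Sum>i<m. y i * b j i) = 0) \<Longrightarrow> i < m \<Longrightarrow> y i = 0"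
  using assms unfolding balanced_pm1_basis_def by simp_all

text \<open>
  The vectors after the first are the signs of \<open>k\<close>-subsets of \<open>{..<2 * k}\<close>, namely \<open>{..<k}\<close> and
  the sets obtained from it by exchanging one of \<open>0, \<dots>, k - 2\<close> for \<open>k\<close>, or \<open>0\<close> for one of
  \<open>k + 1, \<dots>, 2 * k - 1\<close>. A vector orthogonal to all of them has equal entries except possibly
  at \<open>k - 1\<close>, and the sums over \<open>{..<k}\<close> and \<open>{..<2 * k}\<close> then show that it vanishes.
\<close>

definition half_set :: "nat \<Rightarrow> nat \<Rightarrow> nat set" where
  "half_set k j = (if j = 0 then {..<2 * k} else if j = k then {..<k}
     else if j < k then insert k ({..<k} - {j - 1}) else insert j ({..<k} - {0}))"

lemma sum_half_set:
  fixes y :: "nat \<Rightarrow> real"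
  assumes "0 < j" "j < 2 * k"
  shows "sum y (half_set k j) = sum y {..<k} +
    (if j = k then 0 else if j < k then y k - y (j - 1) else y j - y 0)"
  using assms by (auto simp: half_set_def sum_diff1)

lemma balanced_pm1_basis_even:
  assumes k: "k > 0"
  shows "balanced_pm1_basis (2 * k) (\<lambda>j i. if i \<in> half_set k j then 1 else -1)"
    (is "balanced_pm1_basis _ ?b")
proof -
  have sub: "half_set k j \<subseteq> {..<2 * k}" if "j < 2 * k" for j
    using that by (auto simp: half_set_def)
  have sum_b: "(\<Sum>i<2 * k. y i * ?b j i) = 2 * sum y (half_set k j) - sum y {..<2 * k}"
    if "j < 2 * k" for y :: "nat \<Rightarrow> real" and j
  proof -
    have "(\<Sum>i<2 * k. y i * ?b j i) = (\<Sum>i<2 * k. 2 * (if i \<in> half_set k j then y i else 0) - y i)"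
      by (rule sum.cong) auto
    also have "\<dots> = 2 * (\<Sum>i<2 * k. if i \<in> half_set k j then y i else 0) - sum y {..<2 * k}"
      by (simp add: sum_subtractf sum_distrib_left)
    also have "(\<Sum>i<2 * k. if i \<in> half_set k j then y i else 0) = sum y (half_set k j)"
      using sub[OF that] by (simp add: sum.If_cases Int_absorb1)
    finally show ?thesis .
  qed
  \<comment> \<open>Taking \<open>y\<close> constantly 1 shows that \<open>half_set k j\<close> has
    \<open>k\<close> elements, half of \<open>2 * k\<close>.\<close>
  have "(\<Sum>i<2 * k. ?b j i) = 0" if "j < 2 * k" "j > 0" for j
    using sum_b[OF that(1), of "\<lambda>_. 1"] sum_half_set[of j k "\<lambda>_. 1"] that
    by (simp split: if_splits)
  moreover have "y i = 0" if y: "\<forall>j<2 * k. (\<Sum>i<2 * k. y i * ?b j i) = 0" and i: "i < 2 * k" for y i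
  proof -
    have b0: "2 * sum y (half_set k j) = sum y {..<2 * k}" if "j < 2 * k" for j
      using y sum_b[OF that, of y] that by simp
    have total: "sum y {..<2 * k} = 0"
      using b0[of 0] k by (simp add: half_set_def)
    have half: "sum y {..<k} = 0"
      using b0[of k] sum_half_set[of k k y] total k by simp
    \<comment> \<open>Vector \<open>Suc j\<close> exchanges \<open>j\<close> for \<open>k\<close>;
      the bound \<open>Suc j < k\<close> leaves out the entry at \<open>k - 1\<close>.\<close>
    have lo: "y j = y k" if "Suc j < k" for j
      using b0[of "Suc j"] sum_half_set[of "Suc j" k y] total half that by simp
    have hi: "y j = y 0" if "k < j" "j < 2 * k" for j
      using b0[of j] sum_half_set[of j k y] total half that by simp
    have rest: "y j = y k" if "j < 2 * k" "j \<noteq> k - 1" for j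
    proof (cases "j < k")
      case True
      then show ?thesis using lo[of j] that by simp
    next
      case False
      show ?thesis
      proof (cases "j = k")
        case False
        \<comment> \<open>An index strictly between \<open>k\<close> and \<open>2 * k\<close> exists
          only if \<open>k\<close> is at least 2; then \<open>lo\<close> applies at 0 and links
          \<open>y 0\<close> to \<open>y k\<close>.\<close>
        then have "k < j" "Suc 0 < k" using \<open>\<not> j < k\<close> that by auto
        then show ?thesis using hi[of j] lo[of 0] that by simp
      qed simp
    qed
    have "sum y {..<k} = y (k - 1) + sum y ({..<k} - {k - 1})"
      using k by (intro sum.remove) auto
    also have "sum y ({..<k} - {k - 1}) = (\<Sum>j\<in>{..<k} - {k - 1}. y k)"
      by (rule sum.cong) (use rest in auto)
    finally have 1: "y (k - 1) + (real k - 1) * y k = 0"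
      using half k by (simp add: of_nat_diff)
    have "sum y {..<2 * k} = y (k - 1) + sum y ({..<2 * k} - {k - 1})"
      using k by (intro sum.remove) auto
    also have "sum y ({..<2 * k} - {k - 1}) = (\<Sum>j\<in>{..<2 * k} - {k - 1}. y k)"
      by (rule sum.cong) (use rest in auto)
    finally have 2: "y (k - 1) + (2 * real k - 1) * y k = 0"
      using total k by (simp add: of_nat_diff)
    \<comment> \<open>The sums over \<open>{..<2 * k}\<close> and \<open>{..<k}\<close> differ by
      \<open>k\<close> entries, all equal to \<open>y k\<close>.\<close>
    have "real k * y k = 0" using 1 2 unfolding left_diff_distrib by linarith
    then have "y k = 0" using k by simp
    then show ?thesis using 1 rest[of i] i by (cases "i = k - 1") auto
  qed
  ultimately show ?thesis
    unfolding balanced_pm1_basis_def by (auto simp: half_set_def)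
qed

lemma balanced_pm1_basis_exists:
  assumes "m > 0" "m = 1 \<or> even m"
  obtains b where "balanced_pm1_basis m b"
proof (cases "m = 1")
  case True
  then have "balanced_pm1_basis m (\<lambda>_ _. 1)" by (simp add: balanced_pm1_basis_def)
  then show thesis by (rule that)
next
  case False
  then obtain k where "m = 2 * k" using assms by auto
  then show thesis using balanced_pm1_basis_even[of k] assms(1) that by auto
qed

text \<open>The index \<open>j\<close> encodes the pair \<open>(j div m, j mod m)\<close> of tensor
  factors, and \<open>i - 1\<close> appears because parts are numbered from 1. The eigenvalue is 0
  for the constant function, \<open>p * m\<close> for the others that are constant on the parts, and
  \<open>p * m - m\<close> when the second factor sums to zero, so that every part sum
  vanishes.\<close>

lemma complete_multipartite_eigenbasis:
  assumes v: "\<And>i. i \<in> {1..p} \<Longrightarrow> v i = m" and m: "m > 0"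
    and b: "balanced_pm1_basis p b" and c: "balanced_pm1_basis m c"
  shows "pm1_eigenbasis (complete_multipartite p v)
    (\<lambda>j (i, a). b (j div m) (i - 1) * c (j mod m) a)
    (\<lambda>j. if j = 0 then 0 else if j mod m = 0 then real (p * m) else real (p * m) - real m)"
    (is "pm1_eigenbasis ?G ?f ?ev")
proof -
  have card: "card (pverts ?G) = p * m"
    by (simp add: pverts_complete_multipartite v)
  have vert: "pverts ?G = {1..p} \<times> {..<m}"
    using v by (auto simp: pverts_complete_multipartite)
  have shift: "(\<Sum>i=1..p. g (i - 1)) = (\<Sum>i<p. g i)" for g :: "nat \<Rightarrow> real"
    using sum.atLeast_Suc_atMost_Suc_shift[of "\<lambda>i. g (i - 1)" 0 "p - 1"]
    by (cases p) (auto simp: lessThan_Suc_atMost atMost_atLeast0)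
  have pm: "?f j (i, a) \<in> {-1, 1}" if "j < p * m" "i \<in> {1..p}" "a < m" for j i a
  proof -
    have "j div m < p" "j mod m < m" "i - 1 < p" using that m by (auto simp: less_mult_imp_div_less)
    then have "b (j div m) (i - 1) \<in> {-1, 1}" "c (j mod m) a \<in> {-1, 1}"
      using balanced_pm1_basisD(1)[OF b] balanced_pm1_basisD(1)[OF c] that(3) by blast+
    then show ?thesis by auto
  qed
  have eigen: "laplacian_fun ?G (?f j) (i, a) = ?ev j * ?f j (i, a)"
    if j: "j < p * m" and i: "i \<in> {1..p}" and a: "a < m" for j i a
  proof -
    define r s where "r = j div m" and "s = j mod m"
    have rs: "r < p" "s < m" using j m by (auto simp: r_def s_def less_mult_imp_div_less)
    have part: "part_sum v (?f j) k = b r (k - 1) * sum (c s) {..<m}" if "k \<in> {1..p}" for k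
      using v that by (simp add: r_def s_def sum_distrib_left)
    have tot: "(\<Sum>k=1..p. part_sum v (?f j) k) = sum (b r) {..<p} * sum (c s) {..<m}"
    proof -
      have "(\<Sum>k=1..p. part_sum v (?f j) k) = (\<Sum>k=1..p. b r (k - 1) * sum (c s) {..<m})"
        by (rule sum.cong) (use part in auto)
      then show ?thesis by (simp only: sum_distrib_right[symmetric] shift[of "b r"])
    qed
    have n: "(\<Sum>k=1..p. real (v k)) = real (p * m)" using v by simp
    \<comment> \<open>Part sums and total factor. The case split below evaluates the factors
      \<open>sum (b r) {..<p}\<close> and \<open>sum (c s) {..<m}\<close>: the full size for the
      all-ones vector, zero otherwise.\<close>
    have L: "laplacian_fun ?G (?f j) (i, a) =
        (real (p * m) - real m) * (b r (i - 1) * c s a)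
          - (sum (b r) {..<p} - b r (i - 1)) * sum (c s) {..<m}"
      using laplacian_fun_complete_multipartite[of i p a v "?f j"] i a v tot part[OF i] n
      by (simp add: r_def s_def algebra_simps)
    have j0: "j = 0 \<longleftrightarrow> r = 0 \<and> s = 0"
      unfolding r_def s_def by (metis div_0 div_mult_mod_eq mod_0 mult_0 add_0)
    show ?thesis
    proof (cases "s = 0")
      case False
      then have "sum (c s) {..<m} = 0" using balanced_pm1_basisD(3)[OF c rs(2)] by simp
      then show ?thesis using L False j0 by (simp add: r_def s_def)
    next
      case True
      have c1: "c 0 a' = 1" if "a' < m" for a' by (rule balanced_pm1_basisD(2)[OF c that])
      have sc: "sum (c s) {..<m} = real m" by (simp add: True c1)
      show ?thesis
      proof (cases "r = 0")
        case False
        then have "sum (b r) {..<p} = 0" using balanced_pm1_basisD(3)[OF b rs(1)] by simp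
        then have "laplacian_fun ?G (?f j) (i, a) = real (p * m) * (b r (i - 1) * c s a)"
          using L sc True c1[OF a] by (simp add: algebra_simps)
        then show ?thesis using False True j0 by (simp add: r_def s_def)
      next
        case r: True
        have b1: "b 0 i' = 1" if "i' < p" for i' by (rule balanced_pm1_basisD(2)[OF b that])
        have "i - 1 < p" using i by auto
        then have bi: "b 0 (i - 1) = 1" by (rule b1)
        have "sum (b r) {..<p} = real p" by (simp add: r b1)
        then have "laplacian_fun ?G (?f j) (i, a) = 0"
          using L sc True r c1[OF a] bi by (simp add: algebra_simps)
        then show ?thesis using True r j0 by simp
      qed
    qed
  qed
  have complete: "y (i, a) = 0"
    if y: "\<forall>j<p * m. (\<Sum>u\<in>pverts ?G. y u * ?f j u) = 0" and i: "i \<in> {1..p}" and a: "a < m"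
    for y i a
  proof -
    \<comment> \<open>The two factors separate: for fixed \<open>s\<close>, completeness of
      \<open>b\<close> makes the sum over each part vanish (\<open>inner\<close>); letting
      \<open>s\<close> vary, completeness of \<open>c\<close> then makes the entries vanish.\<close>
    have ortho: "(\<Sum>k<p. (\<Sum>a<m. y (Suc k, a) * c s a) * b r k) = 0" if rs: "r < p" "s < m" for r s
    proof -
      have "r * m + s < p * m"
      proof -
        have "r * m + s < Suc r * m" using rs by simp
        also have "\<dots> \<le> p * m" using rs by (intro mult_le_mono1) simp
        finally show ?thesis .
      qed
      then have "(\<Sum>k=1..p. \<Sum>a<m. y (k, a) * (b r (k - 1) * c s a)) = 0"
        using y[rule_format, of "r * m + s"] rs by (simp add: vert sum.cartesian_product')
      moreover have "(\<Sum>k=1..p. \<Sum>a<m. y (k, a) * (b r (k - 1) * c s a)) =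
          (\<Sum>k=1..p. (\<Sum>a<m. y (Suc (k - 1), a) * c s a) * b r (k - 1))"
        by (rule sum.cong) (auto simp: sum_distrib_left mult_ac)
      ultimately show ?thesis
        using shift[of "\<lambda>k. (\<Sum>a<m. y (Suc k, a) * c s a) * b r k"] by simp
    qed
    have inner: "(\<Sum>a<m. y (Suc k, a) * c s a) = 0" if "k < p" "s < m" for k s
      using balanced_pm1_basisD(4)[OF b ortho[OF _ that(2)] that(1)] by simp
    have "i - 1 < p" using i by auto
    then have "y (Suc (i - 1), a) = 0"
      by (intro balanced_pm1_basisD(4)[OF c, of "\<lambda>a. y (Suc (i - 1), a)"] inner a)
    then show ?thesis using i by simp
  qed
  show ?thesis
    unfolding pm1_eigenbasis_def card
    using pm eigen complete by (auto simp: vert simp del: insert_iff split_conv)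
qed

theorem theorem4p11:
  fixes p :: nat and v :: "nat \<Rightarrow> nat"
  assumes "p \<ge> 1"
    and "\<And>i. i \<in> {1..p} \<Longrightarrow> v i > 0"
    and "\<not> (p = 1 \<and> odd (v 1) \<and> v 1 \<ge> 3)"
  shows "pm1_diagonalizable (complete_multipartite p v) \<longleftrightarrow>
    (\<forall>i\<in>{1..p}. \<forall>j\<in>{1..p}. v i = v j) \<and>
    p \<in> {1} \<union> {2 * k | k. k > 0} \<and>
    v 1 \<in> {1} \<union> {2 * k | k. k > 0}"
proof -
  have one_or_even: "m \<in> {1} \<union> {2 * k | k. k > 0} \<longleftrightarrow> m > 0 \<and> (m = 1 \<or> even m)" for m :: nat
    by (auto elim!: evenE)
  have v1: "v 1 > 0" using assms(1,2) by simp
  show ?thesis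
    unfolding one_or_even
  proof (intro iffI)
    assume "pm1_diagonalizable (complete_multipartite p v)"
    then obtain f ev where basis: "pm1_eigenbasis (complete_multipartite p v) f ev"
      using pm1_diagonalizable_imp_eigenbasis pair_graph_complete_multipartite by blast
    show "(\<forall>i\<in>{1..p}. \<forall>j\<in>{1..p}. v i = v j) \<and> (p > 0 \<and> (p = 1 \<or> even p)) \<and>
      (v 1 > 0 \<and> (v 1 = 1 \<or> even (v 1)))"
    proof (cases "p = 1")
      \<comment> \<open>For a single part only the condition on \<open>v 1\<close> has content, and
        the third assumption excludes exactly its failures.\<close>
      case True
      have "v 1 < 3 \<Longrightarrow> odd (v 1) \<Longrightarrow> v 1 = 1" by presburger
      then show ?thesis using True assms(3) v1 by auto
    next
      case False
      then have "p \<ge> 2" using assms(1) by simp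
      note nec = complete_multipartite_necessary[OF this assms(2) basis]
      have "v i = v j" if "i \<in> {1..p}" "j \<in> {1..p}" for i j
        using bspec[OF nec(1) that(1)] bspec[OF nec(1) that(2)] by (rule trans[OF _ sym])
      moreover have "p > 0" using assms(1) by simp
      ultimately show ?thesis using nec(2,3) v1 by blast
    qed
  next
    assume R: "(\<forall>i\<in>{1..p}. \<forall>j\<in>{1..p}. v i = v j) \<and> (p > 0 \<and> (p = 1 \<or> even p)) \<and>
      (v 1 > 0 \<and> (v 1 = 1 \<or> even (v 1)))"
    then obtain b where b: "balanced_pm1_basis p b" using balanced_pm1_basis_exists[of p] by metis
    from R obtain c where c: "balanced_pm1_basis (v 1) c"
      using balanced_pm1_basis_exists[of "v 1"] by metis
    have "1 \<in> {1..p}" using assms(1) by simp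
    then have "v i = v 1" if "i \<in> {1..p}" for i using R that by blast
    then show "pm1_diagonalizable (complete_multipartite p v)"
      by (rule pm1_eigenbasis_imp_diagonalizable[OF pair_graph_complete_multipartite
            complete_multipartite_eigenbasis[OF _ v1 b c]])
  qed
qed

end
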